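(* Let $\mathcal{A}$ be a (possibly randomized) algorithm for a graph problem whose average sensitivity is given by a function $f(n,m)$, i.e. for every graph $G$ with $n$ vertices and $m$ edges, $\mathbb{E}_{e\sim E}[d_{\mathrm{EM}}(\mathcal{A}(G),\mathcal{A}(G-e))]\le f(n,m)$. Then for every integer $k\ge 1$, the $k$-average sensitivity of $\mathcal{A}$ is at most $\sum_{i=1}^k f(n,m-i+1)$, i.e. for every graph $G=(V,E)$ with $n$ vertices and $m$ edges, $$\mathbb{E}_{e_1,\ldots,e_k\sim E}\bigl[d_{\mathrm{EM}}(\mathcal{A}(G),\mathcal{A}(G-\{e_1,\ldots,e_k\}))\bigr]\le \sum_{i=1}^k f(n,m-i+1),$$ where $e_1,\dots,e_k$ are sampled uniformly at random from $E$.
   Context: Graphs are finite and undirected; for $G=(V,E)$ and $F\subseteq E$, $G-F$ is obtained by deleting the edges of $F$ ($G-e:=G-\{e\}$). A (possibly randomized) algorithm $\mathcal{A}$ for a graph problem outputs on input $G$ a solution that is a subset of $E$ (or of $V$); $\mathcal{A}(G)$ denotes its output distribution. The distance between two solutions is their Hamming distance (size of symmetric difference), and $d_{\mathrm{EM}}$ is the earth mover's distance between distributions of solutions with respect to this Hamming distance. The average sensitivity of $\mathcal{A}$ at $G$ is $\mathbb{E}_{e\sim E}[d_{\mathrm{EM}}(\mathcal{A}(G),\mathcal{A}(G-e))]$ with $e$ uniform in $E$; the $k$-average sensitivity is $\mathbb{E}_{e_1,\ldots,e_k\sim E}[d_{\mathrm{EM}}(\mathcal{A}(G),\mathcal{A}(G-\{e_1,\ldots,e_k\}))]$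 with $e_1,\dots,e_k$ sampled uniformly from $E$. *)

theory Defs
  imports "HOL-Probability.Probability_Mass_Function"
begin

type_synonym 'v graph = "'v set \<times> 'v set set"

abbreviation verts :: "'v graph \<Rightarrow> 'v set" where "verts \<equiv> fst"

abbreviation edges :: "'v graph \<Rightarrow> 'v set set" where "edges \<equiv> snd"

definition simple_graph :: "'v graph \<Rightarrow> bool" where
  "simple_graph G \<longleftrightarrow> finite (verts G) \<and> edges G \<subseteq> {e. e \<subseteq> verts G \<and> card e = 2}"

definition del_edges :: "'v graph \<Rightarrow> 'v set set \<Rightarrow> 'v graph" where
  "del_edges G F = (verts G, edges G - F)"

(* Tagged union, so that one output type serves both for problems whose solutions are sets
   of edges and for problems whose solutions are sets of vertices. *)
datatype 'v element = Vertex 'v | Edge "'v set"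

type_synonym 'v solution = "'v element set"

definition vertex_algorithm :: "('v graph \<Rightarrow> 'v solution pmf) \<Rightarrow> bool" where
  "vertex_algorithm \<A> \<longleftrightarrow>
     (\<forall>G. simple_graph G \<longrightarrow> set_pmf (\<A> G) \<subseteq> Pow (Vertex ` verts G))"

definition edge_algorithm :: "('v graph \<Rightarrow> 'v solution pmf) \<Rightarrow> bool" where
  "edge_algorithm \<A> \<longleftrightarrow>
     (\<forall>G. simple_graph G \<longrightarrow> set_pmf (\<A> G) \<subseteq> Pow (Edge ` edges G))"

definition graph_algorithm :: "('v graph \<Rightarrow> 'v solution pmf) \<Rightarrow> bool" where
  "graph_algorithm \<A> \<longleftrightarrow> vertex_algorithm \<A> \<or> edge_algorithm \<A>"

definition hamming :: "'a set \<Rightarrow> 'a set \<Rightarrow> real" where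
  "hamming S T = real (card (sym_diff S T))"

definition couplings :: "'a pmf \<Rightarrow> 'a pmf \<Rightarrow> ('a \<times> 'a) pmf set" where
  "couplings p q = {c. map_pmf fst c = p \<and> map_pmf snd c = q}"

(* Only meant for distributions supported on finitely many finite sets, as the output
   distributions of graph algorithms are; otherwise card and the Bochner integral may
   take their junk value 0. *)
definition d_EM :: "'a set pmf \<Rightarrow> 'a set pmf \<Rightarrow> real" where
  "d_EM p q =
     (INF c\<in>couplings p q. measure_pmf.expectation c (\<lambda>(S, T). hamming S T))"

(* Only meant for graphs with at least one edge. *)
definition average_sensitivity :: "('v graph \<Rightarrow> 'v solution pmf) \<Rightarrow> 'v graph \<Rightarrow> real" where
  "average_sensitivity \<A> G =
     measure_pmf.expectation (pmf_of_set (edges G))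
       (\<lambda>e. d_EM (\<A> G) (\<A> (del_edges G {e})))"

(* There is no edge to sample from an edgeless graph, so edgeless graphs impose no condition on f. *)
definition average_sensitivity_bound ::
    "('v graph \<Rightarrow> 'v solution pmf) \<Rightarrow> (nat \<Rightarrow> nat \<Rightarrow> real) \<Rightarrow> bool" where
  "average_sensitivity_bound \<A> f \<longleftrightarrow>
     (\<forall>G. simple_graph G \<longrightarrow> edges G \<noteq> {} \<longrightarrow>
        average_sensitivity \<A> G \<le> f (card (verts G)) (card (edges G)))"

(* e_1, ..., e_k drawn uniformly without replacement; requires k <= |E|. *)
definition k_average_sensitivity_distinct ::
    "nat \<Rightarrow> ('v graph \<Rightarrow> 'v solution pmf) \<Rightarrow> 'v graph \<Rightarrow> real" where
  "k_average_sensitivity_distinct k \<A> G =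
     measure_pmf.expectation
       (pmf_of_set {es. length es = k \<and> distinct es \<and> set es \<subseteq> edges G})
       (\<lambda>es. d_EM (\<A> G) (\<A> (del_edges G (set es))))"

(* e_1, ..., e_k drawn uniformly and independently, i.e. with replacement; requires E nonempty.
   Any k is allowed here. Since f(n, j) is a sensitivity bound only for j >= 1, a bound on this
   quantity by the sum of f(n, m - i + 1) has to stop at i = min k m. *)
definition k_average_sensitivity_indep ::
    "nat \<Rightarrow> ('v graph \<Rightarrow> 'v solution pmf) \<Rightarrow> 'v graph \<Rightarrow> real" where
  "k_average_sensitivity_indep k \<A> G =
     measure_pmf.expectation (replicate_pmf k (pmf_of_set (edges G)))
       (\<lambda>es. d_EM (\<A> G) (\<A> (del_edges G (set es))))"

end

(* The earth mover's distance satisfies the triangle inequality on finitely supported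
   distributions (glue two couplings along their common marginal). Deleting the edges one at a
   time, the k-average sensitivity of G is therefore at most the average sensitivity of G plus the
   expected (k-1)-average sensitivity of G - e for a random edge e, and one inducts on k. In the
   model with replacement the induction must allow the edges to be drawn from a superset of the
   current edge set: a draw outside the current edge set changes nothing, and the bound only
   grows with k because f(n, j) is nonnegative whenever a graph with n vertices and j edges exists. *)

theory Submission
  imports Defs
begin

section \<open>Expectations over finitely supported distributions\<close>

lemma expectation_mono_finite:
  fixes g h :: "'a \<Rightarrow> real"
  assumes "finite (set_pmf p)" "\<And>x. x \<in> set_pmf p \<Longrightarrow> g x \<le> h x"
  shows "measure_pmf.expectation p g \<le> measure_pmf.expectation p h"
  using assms by (intro integral_mono_AE) (auto simp: AE_measure_pmf_iff integrable_measure_pmf_finite)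

text \<open>Conditions a random list on its first entry. The law \<open>Q e\<close> of the tail may
  depend on that entry, as it does when drawing without replacement; a constant \<open>Q\<close>
  gives independent draws.\<close>

lemma expectation_bind_Cons:
  fixes h :: "'a list \<Rightarrow> real"
  assumes "finite E" "E \<noteq> {}" "\<And>e. e \<in> E \<Longrightarrow> finite (set_pmf (Q e))"
  shows "measure_pmf.expectation (pmf_of_set E \<bind> (\<lambda>e. map_pmf ((#) e) (Q e))) h =
         (\<Sum>e\<in>E. measure_pmf.expectation (Q e) (\<lambda>es. h (e # es))) / card E"
  using assms
  by (subst pmf_expectation_bind_pmf_of_set) (auto simp: sum_distrib_left divide_inverse mult.commute)

section \<open>Couplings and the earth mover's distance\<close>

lemma hamming_nonneg: "0 \<le> hamming S T"
  by (simp add: hamming_def)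

lemma hamming_triangle:
  assumes "finite S" "finite T" "finite U"
  shows "hamming S U \<le> hamming S T + hamming T U"
proof -
  have "card (sym_diff S U) \<le> card (sym_diff S T \<union> sym_diff T U)"
    using assms by (intro card_mono) auto
  also have "\<dots> \<le> card (sym_diff S T) + card (sym_diff T U)"
    by (rule card_Un_le)
  finally show ?thesis
    by (simp add: hamming_def)
qed

text \<open>The independent coupling \<open>pair_pmf p q\<close> is a witness. Lower bounds on the
  infimum in \<open>d_EM\<close> rely on this.\<close>

lemma couplings_nonempty: "couplings p q \<noteq> {}"
  using map_fst_pair_pmf[of p q] map_snd_pair_pmf[of p q] by (auto simp: couplings_def)

lemma set_pmf_coupling:
  assumes "c \<in> couplings p q"
  shows "set_pmf c \<subseteq> set_pmf p \<times> set_pmf q"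
  using assms by (force simp: couplings_def)

lemma expectation_hamming_nonneg: "0 \<le> measure_pmf.expectation c (\<lambda>(S, T). hamming S T)"
  by (intro integral_nonneg_AE) (auto simp: hamming_nonneg)

lemma bdd_below_coupling_cost:
  "bdd_below ((\<lambda>c. measure_pmf.expectation c (\<lambda>(S, T). hamming S T)) ` couplings p q)"
  by (rule bdd_belowI2[of _ 0]) (rule expectation_hamming_nonneg)

lemma d_EM_le:
  assumes "c \<in> couplings p q"
  shows "d_EM p q \<le> measure_pmf.expectation c (\<lambda>(S, T). hamming S T)"
  unfolding d_EM_def using bdd_below_coupling_cost assms by (rule cINF_lower)

lemma d_EM_nonneg: "0 \<le> d_EM p q"
  unfolding d_EM_def by (intro cINF_greatest couplings_nonempty expectation_hamming_nonneg)

lemma d_EM_self: "d_EM p p = 0"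
proof -
  have "map_pmf (\<lambda>x. (x, x)) p \<in> couplings p p"
    by (simp add: couplings_def map_pmf_comp)
  from d_EM_le[OF this] show ?thesis
    using d_EM_nonneg[of p p] by (simp add: hamming_def)
qed

lemma glue_couplings:
  assumes c: "c \<in> couplings p q" and d: "d \<in> couplings q r"
  obtains t where "map_pmf (\<lambda>(x, y, z). (x, y)) t = c" "map_pmf (\<lambda>(x, y, z). (y, z)) t = d"
proof
  \<comment> \<open>Draw \<open>(x, y)\<close> from \<open>c\<close>, then \<open>z\<close> from
    \<open>d\<close> conditioned on its first coordinate being \<open>y\<close>.\<close>
  define t where
    "t = bind_pmf c (\<lambda>w. map_pmf (\<lambda>v. (fst w, snd w, snd v)) (cond_pmf d {v. snd w = fst v}))"
  have q: "map_pmf snd c = q" "map_pmf fst d = q"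
    using c d by (auto simp: couplings_def)
  \<comment> \<open>\<open>cond_pmf\<close> is meaningful only if the event meets the support; it
    does, as the second marginal of \<open>c\<close> is the first marginal of
    \<open>d\<close>.\<close>
  have ne: "set_pmf d \<inter> {v. snd w = fst v} \<noteq> {}" if "w \<in> set_pmf c" for w
  proof -
    have "snd w \<in> set_pmf (map_pmf fst d)"
      using that by (auto simp: q simp flip: q(1))
    then show ?thesis
      by auto
  qed
  show "map_pmf (\<lambda>(x, y, z). (x, y)) t = c"
    by (simp add: t_def map_bind_pmf map_pmf_comp bind_return_pmf')
  have "map_pmf (\<lambda>(x, y, z). (y, z)) t =
        bind_pmf c (\<lambda>w. map_pmf (\<lambda>v. (snd w, snd v)) (cond_pmf d {v. snd w = fst v}))"
    by (simp add: t_def map_bind_pmf map_pmf_comp)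
  \<comment> \<open>On the support of the conditioned distribution \<open>fst v = snd w\<close>, so
    the mapped function is the identity there.\<close>
  also have "\<dots> = bind_pmf c (\<lambda>w. cond_pmf d {v. snd w = fst v})"
    by (intro bind_pmf_cong refl map_pmf_idI) (use ne in auto)
  also have "\<dots> = bind_pmf q (\<lambda>y. cond_pmf d {v. y = fst v})"
    by (simp add: bind_map_pmf flip: q(1))
  \<comment> \<open>Total probability: mixing the conditionals of \<open>d\<close> over the law
    \<open>q\<close> of its first coordinate restores \<open>d\<close>.\<close>
  also have "\<dots> = d"
  proof (rule bind_cond_pmf_cancel)
    show "set_pmf d \<inter> {v. y = fst v} \<noteq> {}" if "y \<in> set_pmf q" for y
      using that by (auto simp flip: q(2))
    show "set_pmf q \<inter> {y. y = fst v} \<noteq> {}" if "v \<in> set_pmf d" for v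
      using that by (auto simp flip: q(2))
    show "measure d {v. y = fst v} = measure q {y. y = fst v}" if "y = fst v" for y v
      using that by (auto simp: vimage_def intro!: arg_cong2[where f = measure] simp flip: q(2))
  qed
  finally show "map_pmf (\<lambda>(x, y, z). (y, z)) t = d" .
qed

text \<open>Keeps clear of junk values: finite support makes all costs integrable, and finite
  solutions have finite symmetric differences.\<close>

definition finite_dist :: "'a set pmf \<Rightarrow> bool" where
  "finite_dist p \<longleftrightarrow> finite (set_pmf p) \<and> (\<forall>S\<in>set_pmf p. finite S)"

text \<open>No optimal coupling is chosen: the cost bound is shown for every pair of couplings, and
  the infima are taken afterwards.\<close>

lemma d_EM_triangle:
  assumes p: "finite_dist p" and q: "finite_dist q" and r: "finite_dist r"
  shows "d_EM p r \<le> d_EM p q + d_EM q r"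
proof -
  let ?E = "\<lambda>c. measure_pmf.expectation c (\<lambda>(S, T). hamming S T)"
  have glued: "d_EM p r \<le> ?E c + ?E d" if c: "c \<in> couplings p q" and d: "d \<in> couplings q r" for c d
  proof -
    from glue_couplings[OF c d] obtain t where
      t: "map_pmf (\<lambda>(x, y, z). (x, y)) t = c" "map_pmf (\<lambda>(x, y, z). (y, z)) t = d" .
    have sub: "set_pmf t \<subseteq> set_pmf p \<times> set_pmf q \<times> set_pmf r"
      using set_pmf_coupling[OF c] set_pmf_coupling[OF d] unfolding t[symmetric] by force
    then have fin: "finite (set_pmf t)"
      by (rule finite_subset) (use p q r in \<open>auto simp: finite_dist_def\<close>)
    have "map_pmf (\<lambda>(x, y, z). (x, z)) t \<in> couplings p r"
    proof -
      have "map_pmf fst (map_pmf (\<lambda>(x, y, z). (x, z)) t) = map_pmf fst c"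
        "map_pmf snd (map_pmf (\<lambda>(x, y, z). (x, z)) t) = map_pmf snd d"
        by (simp_all add: map_pmf_comp case_prod_unfold flip: t)
      with c d show ?thesis
        by (simp add: couplings_def)
    qed
    then have "d_EM p r \<le> measure_pmf.expectation t (\<lambda>(x, y, z). hamming x z)"
      using d_EM_le by (fastforce simp: case_prod_unfold)
    also have "\<dots> \<le> measure_pmf.expectation t
        (\<lambda>w. (case w of (x, y, z) \<Rightarrow> hamming x y) + (case w of (x, y, z) \<Rightarrow> hamming y z))"
    proof (rule expectation_mono_finite[OF fin])
      fix w
      assume "w \<in> set_pmf t"
      with sub p q r show "(case w of (x, y, z) \<Rightarrow> hamming x z) \<le>
          (case w of (x, y, z) \<Rightarrow> hamming x y) + (case w of (x, y, z) \<Rightarrow> hamming y z)"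
        by (auto simp: finite_dist_def intro!: hamming_triangle)
    qed
    also have "\<dots> = ?E c + ?E d"
      using fin by (simp add: integrable_measure_pmf_finite case_prod_unfold flip: t)
    finally show ?thesis .
  qed
  \<comment> \<open>First the infimum over \<open>d\<close> with \<open>c\<close> fixed, then the
    infimum over \<open>c\<close>.\<close>
  have "d_EM p r - ?E c \<le> d_EM q r" if "c \<in> couplings p q" for c
    unfolding d_EM_def[of q r] using glued[OF that]
    by (intro cINF_greatest couplings_nonempty) (simp add: algebra_simps)
  then have "d_EM p r - d_EM q r \<le> d_EM p q"
    unfolding d_EM_def[of p q]
    by (intro cINF_greatest couplings_nonempty) (simp add: algebra_simps)
  then show ?thesis
    by simp
qed

section \<open>Edge deletion and the sensitivity bound\<close>

lemma finite_edges: "simple_graph G \<Longrightarrow> finite (edges G)"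
  by (auto simp: simple_graph_def intro: finite_subset[of _ "Pow (verts G)"])

lemma simple_graph_del_edges: "simple_graph G \<Longrightarrow> simple_graph (del_edges G F)"
  by (auto simp: simple_graph_def del_edges_def)

lemma verts_del_edges [simp]: "verts (del_edges G F) = verts G"
  and edges_del_edges [simp]: "edges (del_edges G F) = edges G - F"
  by (simp_all add: del_edges_def)

lemma del_edges_insert_set: "del_edges G (insert e (set es)) = del_edges (del_edges G {e}) (set es)"
  by (auto simp: del_edges_def)

lemma del_edges_disjoint: "edges G \<inter> F = {} \<Longrightarrow> del_edges G F = G"
  by (auto simp: del_edges_def prod_eq_iff)

text \<open>All outputs are subsets of one finite ground set, the tagged vertices or the tagged
  edges.\<close>

lemma finite_dist_graph_algorithm:
  assumes "graph_algorithm \<A>" "simple_graph G"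
  shows "finite_dist (\<A> G)"
proof -
  obtain B where B: "finite B" "set_pmf (\<A> G) \<subseteq> Pow B"
  proof (cases "vertex_algorithm \<A>")
    case True
    with assms(2) have "set_pmf (\<A> G) \<subseteq> Pow (Vertex ` verts G)"
      unfolding vertex_algorithm_def by blast
    with assms(2) show ?thesis
      by (intro that[of "Vertex ` verts G"]) (simp_all add: simple_graph_def)
  next
    case False
    with assms have "set_pmf (\<A> G) \<subseteq> Pow (Edge ` edges G)"
      unfolding graph_algorithm_def edge_algorithm_def by blast
    with assms(2) show ?thesis
      by (intro that[of "Edge ` edges G"]) (simp_all add: finite_edges)
  qed
  show ?thesis
    unfolding finite_dist_def
  proof
    show "finite (set_pmf (\<A> G))"
      using B by (simp add: finite_subset)
    show "\<forall>S\<in>set_pmf (\<A> G). finite S"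
      using B by (blast intro: finite_subset)
  qed
qed

text \<open>The average cleared of its denominator. For an edgeless graph, where \<open>f\<close> is
  unconstrained, both sides are 0.\<close>

lemma sum_d_EM_le:
  fixes \<A> :: "'v graph \<Rightarrow> 'v solution pmf" and f :: "nat \<Rightarrow> nat \<Rightarrow> real"
    and G :: "'v graph"
  assumes "average_sensitivity_bound \<A> f" "simple_graph G"
  shows "(\<Sum>e\<in>edges G. d_EM (\<A> G) (\<A> (del_edges G {e})))
         \<le> card (edges G) * f (card (verts G)) (card (edges G))"
proof (cases "edges G = {}")
  case False
  have fin: "finite (edges G)"
    using assms(2) by (rule finite_edges)
  with False have "card (edges G) > 0"
    by (simp add: card_gt_0_iff)
  moreover have "average_sensitivity \<A> G \<le> f (card (verts G)) (card (edges G))"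
    using assms False unfolding average_sensitivity_bound_def by blast
  ultimately show ?thesis
    using False fin by (simp add: average_sensitivity_def integral_pmf_of_set field_simps)
qed simp

text \<open>A spanning subgraph of \<open>G\<close> with exactly \<open>j\<close> edges has
  nonnegative average sensitivity, and \<open>f\<close> bounds it from above.\<close>

lemma sensitivity_bound_nonneg:
  fixes \<A> :: "'v graph \<Rightarrow> 'v solution pmf" and f :: "nat \<Rightarrow> nat \<Rightarrow> real"
    and G :: "'v graph"
  assumes "average_sensitivity_bound \<A> f" "simple_graph G" "1 \<le> j" "j \<le> card (edges G)"
  shows "0 \<le> f (card (verts G)) j"
proof -
  obtain F where F: "F \<subseteq> edges G" "card F = j"
    using assms(4) obtain_subset_with_card_n by metis
  define H where "H = del_edges G (edges G - F)"
  have H: "simple_graph H" "verts H = verts G" "edges H = F"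
    using F assms(2) by (auto simp: H_def simple_graph_del_edges)
  have "0 \<le> (\<Sum>e\<in>edges H. d_EM (\<A> H) (\<A> (del_edges H {e})))"
    by (intro sum_nonneg d_EM_nonneg)
  also have "\<dots> \<le> j * f (card (verts G)) j"
    using sum_d_EM_le[OF assms(1) H(1)] H F by simp
  finally show ?thesis
    using assms(3) by (simp add: zero_le_mult_iff)
qed

text \<open>Triangle inequality through \<open>\<A> (del_edges G {e})\<close>. The first summand
  does not depend on the later draws; the second has the form of the induction hypothesis for
  \<open>del_edges G {e}\<close>. \<open>Q\<close> is arbitrary so as to serve both sampling
  models.\<close>

lemma expectation_first_deletion:
  assumes \<A>: "graph_algorithm \<A>" and G: "simple_graph G" and Q: "finite (set_pmf Q)"
  shows "measure_pmf.expectation Q (\<lambda>es. d_EM (\<A> G) (\<A> (del_edges G (set (e # es)))))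
         \<le> d_EM (\<A> G) (\<A> (del_edges G {e})) +
           measure_pmf.expectation Q
             (\<lambda>es. d_EM (\<A> (del_edges G {e})) (\<A> (del_edges (del_edges G {e}) (set es))))"
proof -
  have "measure_pmf.expectation Q (\<lambda>es. d_EM (\<A> G) (\<A> (del_edges G (set (e # es)))))
        \<le> measure_pmf.expectation Q (\<lambda>es. d_EM (\<A> G) (\<A> (del_edges G {e})) +
            d_EM (\<A> (del_edges G {e})) (\<A> (del_edges (del_edges G {e}) (set es))))"
    by (intro expectation_mono_finite[OF Q])
      (simp add: del_edges_insert_set d_EM_triangle finite_dist_graph_algorithm[OF \<A>]
        simple_graph_del_edges G)
  also have "\<dots> = d_EM (\<A> G) (\<A> (del_edges G {e})) + measure_pmf.expectation Q
      (\<lambda>es. d_EM (\<A> (del_edges G {e})) (\<A> (del_edges (del_edges G {e}) (set es))))"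
    using Q by (simp add: integrable_measure_pmf_finite)
  finally show ?thesis .
qed

section \<open>Sampling without replacement\<close>

lemma finite_distinct_lists:
  "finite E \<Longrightarrow> finite {es. length es = k \<and> distinct es \<and> set es \<subseteq> E}"
  by (auto intro: finite_subset[OF _ finite_lists_length_eq[of E k]])

text \<open>\<open>pmf_of_set\<close> is uniform only on a nonempty finite set; this is where
  \<open>k \<le> card E\<close> enters.\<close>

lemma distinct_lists_nonempty:
  assumes "finite E" "k \<le> card E"
  shows "{es. length es = k \<and> distinct es \<and> set es \<subseteq> E} \<noteq> {}"
proof -
  obtain F where F: "F \<subseteq> E" "card F = k" "finite F"
    using obtain_subset_with_card_n[OF assms(2)] by metis
  then obtain es where "set es = F" "distinct es"
    using finite_distinct_list by blast
  with F show ?thesis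
    by (auto simp: distinct_card)
qed

text \<open>Grouping the lists by first entry gives disjoint classes of equal size, so a uniform
  list is a uniform class followed by a uniform member of it.\<close>

lemma pmf_of_set_distinct_lists_Suc:
  assumes E: "finite E" and k: "Suc k \<le> card E"
  shows "pmf_of_set {es. length es = Suc k \<and> distinct es \<and> set es \<subseteq> E} =
         pmf_of_set E \<bind> (\<lambda>e. map_pmf ((#) e)
           (pmf_of_set {es. length es = k \<and> distinct es \<and> set es \<subseteq> E - {e}}))"
proof -
  define L where "L = (\<lambda>e. {es. length es = k \<and> distinct es \<and> set es \<subseteq> E - {e}})"
  have ne: "E \<noteq> {}"
    using k by auto
  have fin: "finite (L e)" for e
    using E by (simp add: L_def finite_distinct_lists)
  \<comment> \<open>This falling factorial depends on \<open>card E\<close> and \<open>k\<close> but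
    not on \<open>e\<close>: the classes have equal size.\<close>
  have card: "card (L e) = \<Prod>{card E - 1 - k + 1..card E - 1}" if "e \<in> E" for e
    using that E k unfolding L_def
    by (subst card_lists_distinct_length_eq) (auto simp: card_Diff_singleton)
  have L: "L e \<noteq> {}" if "e \<in> E" for e
    using that E k distinct_lists_nonempty[of "E - {e}" k] by (simp add: L_def card_Diff_singleton)
  have "{es. length es = Suc k \<and> distinct es \<and> set es \<subseteq> E} = (\<Union>e\<in>E. (#) e ` L e)"
    by (auto simp: L_def length_Suc_conv image_iff)
  also have "pmf_of_set \<dots> = pmf_of_set E \<bind> (\<lambda>e. pmf_of_set ((#) e ` L e))"
    using E ne fin L card
    by (intro pmf_of_set_UN) (auto simp: card_image disjoint_family_on_def)
  also have "\<dots> = pmf_of_set E \<bind> (\<lambda>e. map_pmf ((#) e) (pmf_of_set (L e)))"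
    using E ne fin L
    by (intro bind_pmf_cong refl, subst map_pmf_of_set_inj) auto
  finally show ?thesis
    unfolding L_def .
qed

text \<open>\<open>f m\<close> pays for the first deletion; the rest, reindexed, is the bound for
  one edge fewer. From \<open>k < m\<close> follows \<open>m - 1 + 1 = m\<close> despite truncated
  subtraction.\<close>

lemma sum_sensitivity_bound_Suc:
  fixes f :: "nat \<Rightarrow> real"
  assumes "k < m"
  shows "(\<Sum>i=1..Suc k. f (m - i + 1)) = f m + (\<Sum>i=1..k. f (m - 1 - i + 1))"
proof -
  have "(\<Sum>i=1..Suc k. f (m - i + 1)) = f m + (\<Sum>i=Suc 1..Suc k. f (m - i + 1))"
    using assms by (subst sum.atLeast_Suc_atMost) auto
  also have "(\<Sum>i=Suc 1..Suc k. f (m - i + 1)) = (\<Sum>i=1..k. f (m - 1 - i + 1))"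
    by (subst sum.shift_bounds_cl_Suc_ivl) simp
  finally show ?thesis .
qed

lemma k_average_sensitivity_distinct_le:
  fixes \<A> :: "'v graph \<Rightarrow> 'v solution pmf" and f :: "nat \<Rightarrow> nat \<Rightarrow> real"
    and G :: "'v graph"
  assumes \<A>: "graph_algorithm \<A>" and f: "average_sensitivity_bound \<A> f"
    and "simple_graph G" "k \<le> card (edges G)"
  shows "k_average_sensitivity_distinct k \<A> G
         \<le> (\<Sum>i=1..k. f (card (verts G)) (card (edges G) - i + 1))"
  using assms(3,4)
proof (induction k arbitrary: G)
  case 0
  have "{es. length es = 0 \<and> distinct es \<and> set es \<subseteq> edges G} = {[]}"
    by auto
  then show ?case
    by (simp add: k_average_sensitivity_distinct_def pmf_of_set_singleton d_EM_self
        del_edges_disjoint)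
next
  case (Suc k)
  let ?n = "card (verts G)" and ?m = "card (edges G)"
  let ?Q = "\<lambda>e. pmf_of_set {es. length es = k \<and> distinct es \<and> set es \<subseteq> edges G - {e}}"
  let ?d = "\<lambda>e. d_EM (\<A> G) (\<A> (del_edges G {e}))"
  let ?B = "\<Sum>i=1..k. f ?n (?m - 1 - i + 1)"
  have fin: "finite (edges G)"
    using Suc.prems(1) by (rule finite_edges)
  have m: "?m > 0" and ne: "edges G \<noteq> {}"
    using Suc.prems(2) by auto
  have finQ: "finite (set_pmf (?Q e))" if "e \<in> edges G" for e
    using that fin Suc.prems(2) finite_distinct_lists[of "edges G - {e}" k]
      distinct_lists_nonempty[of "edges G - {e}" k]
    by (simp add: card_Diff_singleton)
  have "k_average_sensitivity_distinct (Suc k) \<A> G =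
      (\<Sum>e\<in>edges G. measure_pmf.expectation (?Q e)
        (\<lambda>es. d_EM (\<A> G) (\<A> (del_edges G (set (e # es)))))) / ?m"
    unfolding k_average_sensitivity_distinct_def pmf_of_set_distinct_lists_Suc[OF fin Suc.prems(2)]
    using fin ne finQ by (rule expectation_bind_Cons)
  also have "\<dots> \<le> (\<Sum>e\<in>edges G. ?d e + ?B) / ?m"
  proof (intro divide_right_mono sum_mono)
    fix e
    assume e: "e \<in> edges G"
    \<comment> \<open>\<open>del_edges G {e}\<close> has \<open>?m - 1 \<ge> k\<close> edges, so the
      induction hypothesis gives the same \<open>?B\<close> for every \<open>e\<close>.\<close>
    have "k_average_sensitivity_distinct k \<A> (del_edges G {e}) \<le> ?B"
      using Suc.IH[of "del_edges G {e}"] Suc.prems e fin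
      by (simp add: simple_graph_del_edges card_Diff_singleton)
    then show "measure_pmf.expectation (?Q e) (\<lambda>es. d_EM (\<A> G) (\<A> (del_edges G (set (e # es)))))
        \<le> ?d e + ?B"
      using expectation_first_deletion[OF \<A> Suc.prems(1) finQ[OF e], of e]
      by (simp add: k_average_sensitivity_distinct_def)
  qed simp
  also have "\<dots> \<le> (?m * f ?n ?m + ?m * ?B) / ?m"
    using sum_d_EM_le[OF f Suc.prems(1)] by (intro divide_right_mono) (simp_all add: sum.distrib)
  also have "\<dots> = f ?n ?m + ?B"
    using m by (simp add: add_divide_distrib)
  also have "\<dots> = (\<Sum>i=1..Suc k. f ?n (?m - i + 1))"
    using Suc.prems(2) by (subst sum_sensitivity_bound_Suc) auto
  finally show ?case .
qed

section \<open>Sampling with replacement\<close>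

lemma expectation_iid_deletions_le:
  fixes \<A> :: "'v graph \<Rightarrow> 'v solution pmf" and f :: "nat \<Rightarrow> nat \<Rightarrow> real"
    and G :: "'v graph"
  assumes \<A>: "graph_algorithm \<A>" and f: "average_sensitivity_bound \<A> f"
    and E: "finite E" "E \<noteq> {}" and "simple_graph G" "edges G \<subseteq> E"
  shows "measure_pmf.expectation (replicate_pmf k (pmf_of_set E))
           (\<lambda>es. d_EM (\<A> G) (\<A> (del_edges G (set es))))
         \<le> (\<Sum>i=1..min k (card (edges G)). f (card (verts G)) (card (edges G) - i + 1))"
  using assms(5,6)
proof (induction k arbitrary: G)
  case 0
  then show ?case
    by (simp add: d_EM_self del_edges_disjoint)
next
  case (Suc k)
  show ?case
  proof (cases "edges G = {}")
    \<comment> \<open>No draw changes an edgeless graph, and \<open>min (Suc k) 0\<close> makes the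
      sum on the right empty.\<close>
    case True
    then show ?thesis
      by (simp add: d_EM_self del_edges_disjoint)
  next
    case False
    let ?n = "card (verts G)" and ?m = "card (edges G)"
    let ?Q = "replicate_pmf k (pmf_of_set E)"
    let ?d = "\<lambda>e. d_EM (\<A> G) (\<A> (del_edges G {e}))"
    let ?B = "\<Sum>i=1..min (Suc k) ?m. f ?n (?m - i + 1)"
    have fin: "finite (edges G)"
      using Suc.prems(1) by (rule finite_edges)
    with False have m: "?m > 0"
      by (simp add: card_gt_0_iff)
    \<comment> \<open>Without its first term, \<open>?B\<close> is the bound for \<open>k\<close>
      draws on a graph with \<open>?m - 1\<close> edges, that is, after a draw that hits
      \<open>edges G\<close>.\<close>
    have B: "?B = f ?n ?m + (\<Sum>i=1..min k (?m - 1). f ?n (?m - 1 - i + 1))"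
    proof -
      have "min (Suc k) ?m = Suc (min k (?m - 1))" "min k (?m - 1) < ?m"
        using m by auto
      then show ?thesis
        by (simp only: sum_sensitivity_bound_Suc)
    qed
    have finQ: "finite (set_pmf ?Q)"
      using E finite_lists_length_eq[of E k]
      by (auto simp: set_replicate_pmf lists_eq_set conj_commute)
    let ?x = "\<lambda>e. measure_pmf.expectation ?Q (\<lambda>es. d_EM (\<A> G) (\<A> (del_edges G (set (e # es)))))"
    have in_G: "?x e \<le> ?d e + (?B - f ?n ?m)" if "e \<in> edges G" for e
      using Suc.IH[of "del_edges G {e}"] Suc.prems that fin
        expectation_first_deletion[OF \<A> Suc.prems(1) finQ, of e]
      unfolding B by (fastforce simp: simple_graph_del_edges card_Diff_singleton)
    have notin_G: "?x e \<le> ?B" if "e \<notin> edges G" for e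
    proof -
      have "?x e \<le> (\<Sum>i=1..min k ?m. f ?n (?m - i + 1))"
        using Suc.IH[of G] Suc.prems that by (simp add: del_edges_insert_set del_edges_disjoint)
      \<comment> \<open>At most one term is added. Its index is at most \<open>?m\<close>, so
        \<open>?m - i + 1\<close> lies between 1 and \<open>?m\<close> and the term is
        nonnegative.\<close>
      also have "\<dots> \<le> ?B"
        using sensitivity_bound_nonneg[OF f Suc.prems(1)] m by (intro sum_mono2) auto
      finally show ?thesis .
    qed
    have "measure_pmf.expectation (replicate_pmf (Suc k) (pmf_of_set E))
        (\<lambda>es. d_EM (\<A> G) (\<A> (del_edges G (set es)))) = (\<Sum>e\<in>E. ?x e) / card E"
      using expectation_bind_Cons[OF E, of "\<lambda>_. ?Q"] finQ by (simp add: map_pmf_def)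
    also have "(\<Sum>e\<in>E. ?x e) = (\<Sum>e\<in>edges G. ?x e) + (\<Sum>e\<in>E - edges G. ?x e)"
      using E Suc.prems by (simp add: sum.subset_diff)
    also have "(\<Sum>e\<in>edges G. ?x e) \<le> (\<Sum>e\<in>edges G. ?d e + (?B - f ?n ?m))"
      by (intro sum_mono in_G)
    \<comment> \<open>The distances sum to at most \<open>?m * f ?n ?m\<close>, which cancels what
      \<open>in_G\<close> subtracts. Hits thus cost at most \<open>?B\<close> on average, as misses
      do.\<close>
    also have "\<dots> \<le> ?m * ?B"
      using sum_d_EM_le[OF f Suc.prems(1)] by (simp add: sum.distrib right_diff_distrib)
    also have "(\<Sum>e\<in>E - edges G. ?x e) \<le> (\<Sum>e\<in>E - edges G. ?B)"
      by (intro sum_mono notin_G) simp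
    also have "?m * ?B + (\<Sum>e\<in>E - edges G. ?B) = card E * ?B"
      using E Suc.prems fin
      by (simp add: card_Diff_subset card_mono of_nat_diff algebra_simps)
    finally show ?thesis
      using E by (simp add: divide_right_mono)
  qed
qed

theorem mainTheorem1:
  fixes \<A> :: "'v graph \<Rightarrow> 'v solution pmf"
    and f :: "nat \<Rightarrow> nat \<Rightarrow> real"
    and G :: "'v graph"
    and k n m :: nat
  assumes "graph_algorithm \<A>"
    and "average_sensitivity_bound \<A> f"
    and "k \<ge> 1"
    and "simple_graph G"
    and "card (verts G) = n"
    and "card (edges G) = m"
    and "m \<ge> 1"
  shows "(k \<le> m \<longrightarrow>
            k_average_sensitivity_distinct k \<A> G \<le> (\<Sum>i=1..k. f n (m - i + 1))) \<and>
         k_average_sensitivity_indep k \<A> G \<le> (\<Sum>i=1..min k m. f n (m - i + 1))"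
proof -
  have "edges G \<noteq> {}"
    using assms(6,7) by auto
  \<comment> \<open>The superset \<open>E\<close> of the independent model is instantiated with
    \<open>edges G\<close> itself.\<close>
  then show ?thesis
    using k_average_sensitivity_distinct_le[OF assms(1,2,4), of k]
      expectation_iid_deletions_le[OF assms(1,2) finite_edges[OF assms(4)] _ assms(4) subset_refl, of k]
      assms(5,6)
    by (simp add: k_average_sensitivity_indep_def)
qed

end
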